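(* Let $f,g_1,\dots,g_m:\mathbb{R}^n\to\mathbb{R}$ be locally Lipschitz, let $\Omega=\{x\in\mathbb{R}^n\mid g_i(x)\le 0,\ i=1,\dots,m\}$, let $\phi(x)=\max\{0,g_1(x),\dots,g_m(x)\}$, and for $\lambda\ge 0$ let $F_\lambda(x)=f(x)+\lambda\phi(x)$. Let $x^*\in\Omega$. Suppose there exist a neighborhood $B$ of $x^*$ and a constant $a>0$ such that $\phi$ has a subdifferential $\partial\phi(x)$ at every $x\in B\setminus\Omega$ and $$\operatorname{dist}\bigl(0,\partial\phi(x)\bigr)\ge a\quad\text{for all } x\in B\setminus\Omega.$$ Then $x^*$ is a local minimizer of $f$ on $\Omega$ if and only if $x^*$ is a local minimizer of $F_\lambda$ on $B$ for all sufficiently large $\lambda>0$.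
   Context: For $A\subseteq\mathbb{R}^n$, $\operatorname{dist}(0,A)=\inf_{v\in A}\|v\|_2$. A locally Lipschitz function $\phi$ has a subdifferential at $x$ (in the sense of Demyanov) if the directional derivative $\phi'(x;d)=\lim_{\alpha\downarrow 0}\frac{\phi(x+\alpha d)-\phi(x)}{\alpha}$ exists for every $d\in\mathbb{R}^n$ and there is a nonempty convex compact set $\partial\phi(x)\subset\mathbb{R}^n$ with $\phi'(x;d)=\max_{v\in\partial\phi(x)}\langle v,d\rangle$ for all $d\in\mathbb{R}^n$; the set $\partial\phi(x)$ is then called the subdifferential of $\phi$ at $x$. (When the $g_i$ are continuously differentiable and $\phi(x)>0$, one has $\partial\phi(x)=\operatorname{conv}\{\nabla g_i(x)\mid g_i(x)=\phi(x)\}$.) *)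

theory Defs
  imports "HOL-Analysis.Analysis"
begin

definition locally_lipschitz :: "('a::metric_space \<Rightarrow> 'b::metric_space) \<Rightarrow> bool" where
  "locally_lipschitz f \<longleftrightarrow> (\<forall>x. \<exists>r>0. \<exists>L. L-lipschitz_on (cball x r) f)"

definition has_directional_derivative ::
    "('a::real_normed_vector \<Rightarrow> real) \<Rightarrow> real \<Rightarrow> 'a \<Rightarrow> 'a \<Rightarrow> bool" where
  "has_directional_derivative \<phi> D x d \<longleftrightarrow>
     ((\<lambda>\<alpha>. (\<phi> (x + \<alpha> *\<^sub>R d) - \<phi> x) / \<alpha>) \<longlongrightarrow> D) (at_right 0)"

(* The last conjunct says that the directional derivative in direction d exists and equals
   the maximum (attained) of v \<bullet> d over S.  Local Lipschitz continuity of \<phi>, under which the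
   notion is considered, is left as a separate assumption on \<phi>. *)
definition has_subdifferential ::
    "('a::euclidean_space \<Rightarrow> real) \<Rightarrow> 'a set \<Rightarrow> 'a \<Rightarrow> bool" where
  "has_subdifferential \<phi> S x \<longleftrightarrow>
     S \<noteq> {} \<and> convex S \<and> compact S \<and>
     (\<forall>d. \<exists>D. has_directional_derivative \<phi> D x d \<and>
          (\<exists>v\<in>S. v \<bullet> d = D) \<and> (\<forall>v\<in>S. v \<bullet> d \<le> D))"

definition subdifferentiable :: "('a::euclidean_space \<Rightarrow> real) \<Rightarrow> 'a \<Rightarrow> bool" where
  "subdifferentiable \<phi> x \<longleftrightarrow> (\<exists>S. has_subdifferential \<phi> S x)"

definition subdifferential :: "('a::euclidean_space \<Rightarrow> real) \<Rightarrow> 'a \<Rightarrow> 'a set" where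
  "subdifferential \<phi> x = (THE S. has_subdifferential \<phi> S x)"

lemma has_subdifferential_subset:
  assumes S: "has_subdifferential \<phi> S x" and T: "has_subdifferential \<phi> T x"
  shows "S \<subseteq> T"
proof
  fix z assume z: "z \<in> S"
  show "z \<in> T"
  proof (rule ccontr)
    assume "z \<notin> T"
    moreover have "convex T" "closed T"
      using T by (auto simp: has_subdifferential_def compact_imp_closed)
    ultimately obtain a b where ab: "a \<bullet> z < b" "\<And>y. y \<in> T \<Longrightarrow> a \<bullet> y > b"
      using separating_hyperplane_closed_point[of T z] by auto
    obtain D where D: "has_directional_derivative \<phi> D x (- a)" "\<forall>v\<in>S. v \<bullet> (- a) \<le> D"
      using conjunct2[OF conjunct2[OF conjunct2[OF S[unfolded has_subdifferential_def]]], rule_format, of "- a"]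
      by auto
    obtain E v where E: "has_directional_derivative \<phi> E x (- a)" "v \<in> T" "v \<bullet> (- a) = E"
      using conjunct2[OF conjunct2[OF conjunct2[OF T[unfolded has_subdifferential_def]]], rule_format, of "- a"]
      by auto
    have "D = E"
      using D(1) E(1) unfolding has_directional_derivative_def
      by (rule tendsto_unique[OF trivial_limit_at_right_real])
    moreover have "z \<bullet> (- a) \<le> D"
      using D(2) z by (rule bspec)
    ultimately show False
      using ab(1) ab(2)[OF E(2)] E(3) inner_commute[of a z] inner_commute[of a v] by simp
  qed
qed

lemma subdifferential_eq:
  assumes "has_subdifferential \<phi> S x"
  shows "subdifferential \<phi> x = S"
  unfolding subdifferential_def
  by (rule the_equality) (use assms in \<open>auto dest: has_subdifferential_subset[of \<phi> S x]
    has_subdifferential_subset[of \<phi> _ x S]\<close>)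

lemma has_subdifferential_subdifferential:
  "subdifferentiable \<phi> x \<Longrightarrow> has_subdifferential \<phi> (subdifferential \<phi> x) x"
  unfolding subdifferentiable_def by (erule exE) (simp add: subdifferential_eq)

definition local_minimizer_on :: "('a::topological_space \<Rightarrow> real) \<Rightarrow> 'a set \<Rightarrow> 'a \<Rightarrow> bool" where
  "local_minimizer_on h A x \<longleftrightarrow>
     x \<in> A \<and> (\<exists>U. open U \<and> x \<in> U \<and> (\<forall>y\<in>U \<inter> A. h x \<le> h y))"

definition feasible_set :: "nat \<Rightarrow> (nat \<Rightarrow> 'a \<Rightarrow> real) \<Rightarrow> 'a set" where
  "feasible_set m g = {x. \<forall>i\<in>{1..m}. g i x \<le> 0}"

definition infeasibility :: "nat \<Rightarrow> (nat \<Rightarrow> 'a \<Rightarrow> real) \<Rightarrow> 'a \<Rightarrow> real" where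
  "infeasibility m g x = Max (insert 0 ((\<lambda>i. g i x) ` {1..m}))"

definition penalty_function ::
    "nat \<Rightarrow> ('a \<Rightarrow> real) \<Rightarrow> (nat \<Rightarrow> 'a \<Rightarrow> real) \<Rightarrow> real \<Rightarrow> 'a \<Rightarrow> real" where
  "penalty_function m f g lam x = f x + lam * infeasibility m g x"

end

theory Submission
  imports Defs
begin

text \<open>The lower bound on the subdifferentials provides, at every infeasible point of \<open>B\<close>, a unit
  direction along which \<open>\<phi>\<close> decreases at rate at least \<open>a\<close>.  Fix \<open>0 < c < a\<close> and \<open>x\<close> near \<open>x\<^sup>*\<close>.  A
  minimizer \<open>y\<close> of \<open>\<phi> + c \<parallel>\<cdot> - x\<parallel>\<close> over a small closed ball around \<open>x\<^sup>*\<close> is interior to the ball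
  and hence feasible, as otherwise a step in the descent direction would improve it.  This is the
  error bound \<open>c \<parallel>y - x\<parallel> \<le> \<phi> x\<close> with \<open>y \<in> \<Omega>\<close>; Lipschitz continuity of \<open>f\<close> then makes any penalty
  parameter \<open>\<ge> L / c\<close> exact.\<close>

lemma locally_lipschitz_continuous_on:
  assumes "locally_lipschitz f"
  shows "continuous_on UNIV f"
  unfolding continuous_on_eq_continuous_at[OF open_UNIV]
proof
  fix x
  obtain r L where "r > 0" "L-lipschitz_on (cball x r) f"
    using assms unfolding locally_lipschitz_def by blast
  then have "continuous_on (ball x r) f"
    by (meson ball_subset_cball continuous_on_subset lipschitz_on_continuous_on)
  then show "isCont f x"
    using \<open>r > 0\<close> by (simp add: continuous_on_eq_continuous_at)
qed

lemma infeasibility_nonneg: "infeasibility m g x \<ge> 0"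
  unfolding infeasibility_def by (rule Max_ge) auto

lemma infeasibility_eq_0_iff: "infeasibility m g x = 0 \<longleftrightarrow> x \<in> feasible_set m g"
proof -
  have "infeasibility m g x \<le> 0 \<longleftrightarrow> x \<in> feasible_set m g"
    unfolding infeasibility_def feasible_set_def by (subst Max_le_iff) auto
  then show ?thesis
    using infeasibility_nonneg[of m g x] by linarith
qed

text \<open>Recursion in \<open>m\<close>, so that continuity of the finite maximum follows by
  induction from that of a binary one.\<close>

lemma infeasibility_Suc: "infeasibility (Suc m) g x = max (g (Suc m) x) (infeasibility m g x)"
proof -
  have "insert 0 ((\<lambda>i. g i x) ` {1..Suc m}) =
      insert (g (Suc m) x) (insert 0 ((\<lambda>i. g i x) ` {1..m}))"
    by (auto simp: atLeastAtMostSuc_conv)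
  then show ?thesis
    unfolding infeasibility_def by (metis Max_insert finite_atLeastAtMost finite_imageI
        finite_insert insert_not_empty)
qed

lemma continuous_on_infeasibility:
  assumes "\<And>i. i \<in> {1..m} \<Longrightarrow> continuous_on A (g i)"
  shows "continuous_on A (infeasibility m g)"
  using assms
proof (induction m)
  case 0
  then show ?case
    by (simp add: infeasibility_def[abs_def])
next
  case (Suc m)
  then show ?case
    by (auto simp: infeasibility_Suc[abs_def] intro!: continuous_on_max)
qed

text \<open>The element \<open>v\<close> of least norm in \<open>S\<close> satisfies
  \<open>w \<bullet> v \<ge> norm v * norm v\<close> for every \<open>w \<in> S\<close>, by the
  variational inequality for projections. Hence along \<open>d = - v / norm v\<close> the whole of
  \<open>S\<close> has inner products at most \<open>- norm v \<le> - a\<close>.\<close>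

lemma has_subdifferential_descent_direction:
  assumes S: "has_subdifferential \<phi> S x" and "a > 0" and a: "infdist 0 S \<ge> a"
  obtains d D where "norm d = 1" "D \<le> - a" "has_directional_derivative \<phi> D x d"
proof -
  have S': "S \<noteq> {}" "convex S" "closed S"
    using S by (auto simp: has_subdifferential_def compact_imp_closed)
  define v where "v = closest_point S 0"
  have "v \<in> S"
    unfolding v_def by (rule closest_point_in_set) (use S' in auto)
  then have va: "norm v \<ge> a"
    using infdist_le[of v S 0] a by simp
  have vw: "w \<bullet> v \<ge> norm v * norm v" if "w \<in> S" for w
    using closest_point_dot[OF S'(2,3) that, of 0]
    by (simp add: v_def[symmetric] inner_diff_right inner_commute norm_eq_square
        flip: power2_norm_eq_inner power2_eq_square)
  define d where "d = - (v /\<^sub>R norm v)"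
  have pos: "norm v > 0"
    using va \<open>a > 0\<close> by linarith
  \<comment> \<open>The maximum defining \<open>D\<close> is attained at some
    \<open>w \<in> S\<close>, so a bound on this one inner product bounds \<open>D\<close>.\<close>
  obtain D w where D: "has_directional_derivative \<phi> D x d" and w: "w \<in> S" "w \<bullet> d = D"
    using S unfolding has_subdifferential_def by blast
  have "D = - ((w \<bullet> v) / norm v)"
    using w(2) by (simp add: d_def divide_inverse mult.commute)
  also have "\<dots> \<le> - norm v"
    using vw[OF w(1)] pos by (simp add: field_simps)
  finally have "D \<le> - a"
    using va by linarith
  moreover have "norm d = 1"
    using pos by (simp add: d_def)
  ultimately show thesis
    using that D by blast
qed

text \<open>A step of length \<open>\<alpha>\<close> from \<open>y\<close> increases the distance to
  \<open>x\<close> by at most \<open>\<alpha>\<close>. By minimality \<phi> then drops by at most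
  \<open>c * \<alpha>\<close>, and this bound on the difference quotients passes to the
  limit.\<close>

lemma local_min_slope_directional_derivative_ge:
  assumes D: "has_directional_derivative \<phi> D y d" and d: "norm d = 1" and c: "c \<ge> 0"
    and U: "open U" "y \<in> U"
    and min: "\<And>z. z \<in> U \<Longrightarrow> \<phi> y + c * norm (y - x) \<le> \<phi> z + c * norm (z - x)"
  shows "D \<ge> - c"
proof (rule tendsto_lowerbound[OF D[unfolded has_directional_derivative_def]])
  have "((\<lambda>\<alpha>. y + \<alpha> *\<^sub>R d) \<longlongrightarrow> y + 0 *\<^sub>R d) (at_right 0)"
    by (intro tendsto_intros)
  then have "\<forall>\<^sub>F \<alpha> in at_right 0. y + \<alpha> *\<^sub>R d \<in> U"
    using topological_tendstoD[OF _ U(1)] U(2) by simp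
  then show "\<forall>\<^sub>F \<alpha> in at_right 0. - c \<le> (\<phi> (y + \<alpha> *\<^sub>R d) - \<phi> y) / \<alpha>"
    using eventually_at_right_less[of "0::real"]
  proof eventually_elim
    case (elim \<alpha>)
    have "norm (y + \<alpha> *\<^sub>R d - x) \<le> norm (y - x) + \<alpha>"
      using norm_triangle_ineq[of "y - x" "\<alpha> *\<^sub>R d"] elim(2) d by (simp add: algebra_simps)
    then have "c * norm (y + \<alpha> *\<^sub>R d - x) \<le> c * norm (y - x) + c * \<alpha>"
      using c by (metis distrib_left mult_left_mono)
    then have "- c * \<alpha> \<le> \<phi> (y + \<alpha> *\<^sub>R d) - \<phi> y"
      using min[OF elim(1)] by simp
    then show ?case
      using elim(2) by (simp add: pos_le_divide_eq)
  qed
qed simp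

lemma subdifferential_error_bound:
  fixes \<phi> :: "'a::euclidean_space \<Rightarrow> real"
  assumes cont: "continuous_on UNIV \<phi>" and nonneg: "\<And>x. \<phi> x \<ge> 0" and p: "\<phi> p = 0"
    and c: "0 < c" "c < a" and "R > 0"
    and sub: "\<And>x. x \<in> ball p R \<Longrightarrow> \<phi> x \<noteq> 0 \<Longrightarrow> subdifferentiable \<phi> x"
    and dist: "\<And>x. x \<in> ball p R \<Longrightarrow> \<phi> x \<noteq> 0 \<Longrightarrow> infdist 0 (subdifferential \<phi> x) \<ge> a"
  obtains U where "open U" "p \<in> U" "U \<subseteq> ball p R"
    "\<And>x. x \<in> U \<Longrightarrow> \<exists>y \<in> ball p R. \<phi> y = 0 \<and> c * norm (y - x) \<le> \<phi> x"
proof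
  \<comment> \<open>The two halves of \<open>R\<close> add up: the bound on \<open>\<phi> x\<close>
    will force \<open>y\<close> within \<open>R / 2\<close> of \<open>x\<close>, and
    \<open>x\<close> is within \<open>R / 2\<close> of \<open>p\<close>, so \<open>y\<close> cannot
    lie on the boundary of the ball.\<close>
  define U where "U = {x. \<phi> x < c * (R / 2)} \<inter> ball p (R / 2)"
  show "open U"
    unfolding U_def by (intro open_Int open_ball open_Collect_less cont continuous_intros)
  show "p \<in> U" "U \<subseteq> ball p R"
    using p c \<open>R > 0\<close> by (auto simp: U_def)
  fix x assume x: "x \<in> U"
  define \<psi> where "\<psi> = (\<lambda>z. \<phi> z + c * norm (z - x))"
  have "continuous_on (cball p R) \<psi>"
    unfolding \<psi>_def by (intro continuous_intros continuous_on_subset[OF cont]) auto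
  then obtain y where y: "y \<in> cball p R" and min: "\<And>z. z \<in> cball p R \<Longrightarrow> \<psi> y \<le> \<psi> z"
    using continuous_attains_inf[of "cball p R" \<psi>] \<open>R > 0\<close> by fastforce
  \<comment> \<open>Comparison with \<open>x\<close> itself, where the distance term vanishes, gives
    both the error bound and the closeness of \<open>y\<close> to \<open>x\<close>.\<close>
  have "x \<in> cball p R"
    using x \<open>R > 0\<close> by (auto simp: U_def)
  from min[OF this] have le: "\<phi> y + c * norm (y - x) \<le> \<phi> x"
    by (simp add: \<psi>_def)
  have "c * norm (y - x) < c * (R / 2)"
    using le nonneg[of y] x by (simp add: U_def)
  then have "dist x y < R / 2"
    using c by (simp add: dist_norm norm_minus_commute)
  moreover have "dist p x < R / 2"
    using x by (simp add: U_def)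
  ultimately have yb: "y \<in> ball p R"
    using dist_triangle[of p y x] by simp
  have "\<phi> y = 0"
  proof (rule ccontr)
    assume "\<phi> y \<noteq> 0"
    then obtain d D where d: "norm d = 1" "D \<le> - a" "has_directional_derivative \<phi> D y d"
      using has_subdifferential_descent_direction[OF
          has_subdifferential_subdifferential[OF sub[OF yb]] _ dist[OF yb]] c
      by (metis order_less_trans)
    have "D \<ge> - c"
      by (rule local_min_slope_directional_derivative_ge[OF d(3,1) _ open_ball yb, of c x])
        (use c min in \<open>auto simp: \<psi>_def\<close>)
    with d(2) c show False
      by linarith
  qed
  then show "\<exists>y \<in> ball p R. \<phi> y = 0 \<and> c * norm (y - x) \<le> \<phi> x"
    using le yb by auto
qed

theorem theorem5p1:
  fixes f :: "real ^ 'n \<Rightarrow> real"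
    and g :: "nat \<Rightarrow> real ^ 'n \<Rightarrow> real"
    and m :: nat
    and xstar :: "real ^ 'n"
    and B :: "(real ^ 'n) set"
    and a :: real
  assumes "locally_lipschitz f"
    and "\<And>i. i \<in> {1..m} \<Longrightarrow> locally_lipschitz (g i)"
    and "xstar \<in> feasible_set m g"
    and "xstar \<in> interior B"
    and "a > 0"
    and "\<And>x. x \<in> B - feasible_set m g \<Longrightarrow> subdifferentiable (infeasibility m g) x"
    and "\<And>x. x \<in> B - feasible_set m g \<Longrightarrow>
           infdist 0 (subdifferential (infeasibility m g) x) \<ge> a"
  shows "local_minimizer_on f (feasible_set m g) xstar \<longleftrightarrow>
         (\<exists>lam0>0. \<forall>lam\<ge>lam0. local_minimizer_on (penalty_function m f g lam) B xstar)"
proof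
  let ?\<Omega> = "feasible_set m g" and ?\<phi> = "infeasibility m g"
  have star: "?\<phi> xstar = 0"
    using assms(3) by (simp add: infeasibility_eq_0_iff)
  have xB: "xstar \<in> B"
    using assms(4) interior_subset by blast
  {
    assume "local_minimizer_on f ?\<Omega> xstar"
    then obtain V where V: "open V" "xstar \<in> V" "\<And>y. y \<in> V \<inter> ?\<Omega> \<Longrightarrow> f xstar \<le> f y"
      unfolding local_minimizer_on_def by blast
    obtain r L where r: "r > 0" and L: "L-lipschitz_on (cball xstar r) f"
      using assms(1) unfolding locally_lipschitz_def by blast
    have "open (V \<inter> interior B \<inter> ball xstar r)" "xstar \<in> V \<inter> interior B \<inter> ball xstar r"
      using V assms(4) r by auto
    \<comment> \<open>One radius serves three purposes: \<open>V\<close> for minimality of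
      \<open>f\<close>, \<open>B\<close> for the subdifferential bound, and the ball of radius
      \<open>r\<close> for the Lipschitz estimate.\<close>
    then obtain R where R: "R > 0" "ball xstar R \<subseteq> V \<inter> interior B \<inter> ball xstar r"
      unfolding open_contains_ball by blast
    have RB: "ball xstar R \<subseteq> B"
      using R(2) interior_subset by blast
    have cont: "continuous_on UNIV ?\<phi>"
      by (intro continuous_on_infeasibility locally_lipschitz_continuous_on assms(2))
    obtain U where U: "open U" "xstar \<in> U" "U \<subseteq> ball xstar R"
      and eb: "\<And>x. x \<in> U \<Longrightarrow> \<exists>y \<in> ball xstar R. ?\<phi> y = 0 \<and> a / 2 * norm (y - x) \<le> ?\<phi> x"
    proof (rule subdifferential_error_bound[OF cont infeasibility_nonneg star, of "a / 2" a R])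
      fix x assume "x \<in> ball xstar R" "?\<phi> x \<noteq> 0"
      then have "x \<in> B - ?\<Omega>"
        using RB by (auto simp: infeasibility_eq_0_iff)
      then show "subdifferentiable ?\<phi> x" "infdist 0 (subdifferential ?\<phi> x) \<ge> a"
        using assms(6,7) by auto
    qed (use assms(5) R(1) in auto)
    have L0: "L \<ge> 0"
      using L by (rule lipschitz_on_nonneg)
    show "\<exists>lam0>0. \<forall>lam\<ge>lam0. local_minimizer_on (penalty_function m f g lam) B xstar"
    \<comment> \<open>The threshold is \<open>L / c\<close> for the choice \<open>c = a / 2\<close>;
      the maximum with 1 keeps it positive when \<open>L = 0\<close>.\<close>
    proof (intro exI[of _ "max 1 (2 * L / a)"] conjI allI impI)
      fix lam assume lam: "max 1 (2 * L / a) \<le> lam"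
      have "penalty_function m f g lam xstar \<le> penalty_function m f g lam x" if x: "x \<in> U" for x
      proof -
        obtain y where y: "y \<in> ball xstar R" "?\<phi> y = 0" "a / 2 * norm (y - x) \<le> ?\<phi> x"
          using eb[OF x] by blast
        have "f xstar \<le> f y"
          by (rule V(3)) (use y R(2) in \<open>auto simp: infeasibility_eq_0_iff\<close>)
        also have "f y \<le> f x + L * norm (y - x)"
        proof -
          have "x \<in> cball xstar r" "y \<in> cball xstar r"
            using x y U(3) R(2) ball_subset_cball by blast+
          from lipschitz_onD[OF L this(2,1)] show ?thesis
            by (simp add: dist_norm)
        qed
        \<comment> \<open>This exposes the left side of the error bound, which trades distance to
          \<open>y\<close> for infeasibility of \<open>x\<close>.\<close>
        also have "L * norm (y - x) = 2 * L / a * (a / 2 * norm (y - x))"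
          using assms(5) by simp
        also have "\<dots> \<le> lam * ?\<phi> x"
          by (rule mult_mono) (use lam y(3) L0 assms(5) in auto)
        finally show ?thesis
          using star by (simp add: penalty_function_def)
      qed
      then show "local_minimizer_on (penalty_function m f g lam) B xstar"
        unfolding local_minimizer_on_def using U xB by blast
    qed simp
  }
  assume "\<exists>lam0>0. \<forall>lam\<ge>lam0. local_minimizer_on (penalty_function m f g lam) B xstar"
  then obtain lam where "local_minimizer_on (penalty_function m f g lam) B xstar"
    by blast
  then obtain U where U: "open U" "xstar \<in> U"
    "\<And>y. y \<in> U \<inter> B \<Longrightarrow> penalty_function m f g lam xstar \<le> penalty_function m f g lam y"
    unfolding local_minimizer_on_def by blast
  \<comment> \<open>A single \<open>lam\<close> suffices, as the penalty vanishes on the feasible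
    set. Intersecting with \<open>interior B\<close> gives an open set inside \<open>B\<close>,
    where minimality is known.\<close>
  have "f xstar \<le> f y" if "y \<in> (U \<inter> interior B) \<inter> ?\<Omega>" for y
  proof -
    have "?\<phi> y = 0" "y \<in> U \<inter> B"
      using that interior_subset by (auto simp: infeasibility_eq_0_iff)
    then show ?thesis
      using U(3)[of y] star by (simp add: penalty_function_def)
  qed
  moreover have "open (U \<inter> interior B)" "xstar \<in> U \<inter> interior B"
    using U assms(4) by auto
  ultimately show "local_minimizer_on f ?\<Omega> xstar"
    unfolding local_minimizer_on_def using assms(3) by blast
qed

end
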